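(* Let $\mathcal{A}$ be a $\mathbf{tDL}$-algebra with associated tense Priestley space $(X(A),R_A)$. Then $\mathcal{A}$ is simple if and only if $C_t(X(A))=\{\emptyset,X(A)\}$.
   Context: A $\mathbf{tDL}$-algebra is a bounded distributive lattice $\langle A,\wedge,\vee,0,1\rangle$ with unary operators $\mathbf{G},\mathbf{H},\mathbf{F},\mathbf{P}$ such that for all $x,y$: $\mathbf{G}1=\mathbf{H}1=1$; $\mathbf{G},\mathbf{H}$ preserve $\wedge$; $x\le\mathbf{G}\mathbf{P}x$, $x\le\mathbf{H}\mathbf{F}x$; $\mathbf{G}(x\vee y)\le\mathbf{G}x\vee\mathbf{F}y$, $\mathbf{H}(x\vee y)\le\mathbf{H}x\vee\mathbf{P}y$; $\mathbf{F}0=\mathbf{P}0=0$; $\mathbf{F},\mathbf{P}$ preserve $\vee$; $\mathbf{P}\mathbf{G}x\le x$, $\mathbf{F}\mathbf{H}x\le x$; $\mathbf{G}x\wedge\mathbf{F}y\le\mathbf{F}(x\wedge y)$, $\mathbf{H}x\wedge\mathbf{P}y\le\mathbf{P}(x\wedge y)$. Simplicity refers to congruences of this algebra (lattice congruences compatible with the four operators). $X(A)$ is the set of prime filters ordered by inclusion with the Priestley topology generated by the sets $\sigma_A(a)=\{T\in X(A):a\in T\}$ and their complements; $(S,T)\in R_A$ iff $\{a:\mathbf{G}a\in S\}\subseteq T\subseteq\{a:\mathbf{F}a\in S\}$. With $R_A(x)=\{y:(x,y)\in R_A\}$, $R_A^{-1}(x)=\{y:(y,x)\in R_A\}$, a subset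 $Y\subseteq X(A)$ is a $\mathbf{tPS}$-set if for all $x,y$: (tc1) if $x\in R_A^{-1}(y)\cap Y$ then there are $w_1,w_2\in R_A(x)\cap Y$ with $w_1\subseteq y\subseteq w_2$; (tc2) if $x\in R_A(y)\cap Y$ then there are $w_1,w_2\in R_A^{-1}(x)\cap Y$ with $w_1\subseteq y\subseteq w_2$. $C_t(X(A))$ is the set of closed $\mathbf{tPS}$-sets. *)

theory Defs
  imports "HOL-Analysis.Abstract_Topology"
begin

text \<open>The carrier of the algebra is the whole type; the one-element algebra (\<open>bot = top\<close>) is
  included.\<close>

locale tDL_algebra =
  fixes G H F P :: "'a::{distrib_lattice, bounded_lattice} \<Rightarrow> 'a"
  assumes G_top: "G top = top"
    and H_top: "H top = top"
    and G_inf: "G (inf x y) = inf (G x) (G y)"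
    and H_inf: "H (inf x y) = inf (H x) (H y)"
    and le_GP: "x \<le> G (P x)"
    and le_HF: "x \<le> H (F x)"
    and G_sup_le: "G (sup x y) \<le> sup (G x) (F y)"
    and H_sup_le: "H (sup x y) \<le> sup (H x) (P y)"
    and F_bot: "F bot = bot"
    and P_bot: "P bot = bot"
    and F_sup: "F (sup x y) = sup (F x) (F y)"
    and P_sup: "P (sup x y) = sup (P x) (P y)"
    and PG_le: "P (G x) \<le> x"
    and FH_le: "F (H x) \<le> x"
    and G_inf_F_le: "inf (G x) (F y) \<le> F (inf x y)"
    and H_inf_P_le: "inf (H x) (P y) \<le> P (inf x y)"

definition tDL_congruence ::
  "('a::{distrib_lattice, bounded_lattice} \<Rightarrow> 'a) \<Rightarrow> ('a \<Rightarrow> 'a) \<Rightarrow> ('a \<Rightarrow> 'a) \<Rightarrow> ('a \<Rightarrow> 'a)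
    \<Rightarrow> ('a \<times> 'a) set \<Rightarrow> bool" where
  "tDL_congruence G H F P \<theta> \<longleftrightarrow>
     equiv UNIV \<theta> \<and>
     (\<forall>a b c d. (a, b) \<in> \<theta> \<longrightarrow> (c, d) \<in> \<theta> \<longrightarrow>
        (inf a c, inf b d) \<in> \<theta> \<and> (sup a c, sup b d) \<in> \<theta>) \<and>
     (\<forall>a b. (a, b) \<in> \<theta> \<longrightarrow>
        (G a, G b) \<in> \<theta> \<and> (H a, H b) \<in> \<theta> \<and> (F a, F b) \<in> \<theta> \<and> (P a, P b) \<in> \<theta>)"

text \<open>The identity and the total relation are the only congruences. They are not required to be
  distinct, so the one-element algebra counts as simple. (Its space of prime filters is empty.)\<close>

definition tDL_simple ::
  "('a::{distrib_lattice, bounded_lattice} \<Rightarrow> 'a) \<Rightarrow> ('a \<Rightarrow> 'a) \<Rightarrow> ('a \<Rightarrow> 'a) \<Rightarrow> ('a \<Rightarrow> 'a)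
    \<Rightarrow> bool" where
  "tDL_simple G H F P \<longleftrightarrow> {\<theta>. tDL_congruence G H F P \<theta>} = {Id, UNIV}"

definition lattice_filter :: "'a::lattice set \<Rightarrow> bool" where
  "lattice_filter T \<longleftrightarrow>
     T \<noteq> {} \<and> (\<forall>a\<in>T. \<forall>b. a \<le> b \<longrightarrow> b \<in> T) \<and> (\<forall>a\<in>T. \<forall>b\<in>T. inf a b \<in> T)"

definition prime_filters :: "'a::lattice set set" where
  "prime_filters =
     {T. lattice_filter T \<and> T \<noteq> UNIV \<and> (\<forall>a b. sup a b \<in> T \<longrightarrow> a \<in> T \<or> b \<in> T)}"

definition stone_map :: "'a::lattice \<Rightarrow> 'a set set" where
  "stone_map a = {T \<in> prime_filters. a \<in> T}"

definition priestley_topology :: "'a::lattice set topology" where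
  "priestley_topology =
     topology_generated_by (range stone_map \<union> range (\<lambda>a. prime_filters - stone_map a))"

text \<open>The order of the Priestley space is inclusion of prime filters. The relation is determined
  by \<open>G\<close> and \<open>F\<close> alone.\<close>

definition tense_rel :: "('a::lattice \<Rightarrow> 'a) \<Rightarrow> ('a \<Rightarrow> 'a) \<Rightarrow> ('a set \<times> 'a set) set" where
  "tense_rel G F =
     {(S, T). S \<in> prime_filters \<and> T \<in> prime_filters \<and> {a. G a \<in> S} \<subseteq> T \<and> T \<subseteq> {a. F a \<in> S}}"

definition tPS_set :: "('a::lattice \<Rightarrow> 'a) \<Rightarrow> ('a \<Rightarrow> 'a) \<Rightarrow> 'a set set \<Rightarrow> bool" where
  "tPS_set G F Y \<longleftrightarrow>
     Y \<subseteq> prime_filters \<and>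
     (\<forall>x\<in>prime_filters. \<forall>y\<in>prime_filters. x \<in> (tense_rel G F)\<inverse> `` {y} \<inter> Y \<longrightarrow>
        (\<exists>w1 \<in> tense_rel G F `` {x} \<inter> Y. \<exists>w2 \<in> tense_rel G F `` {x} \<inter> Y.
           w1 \<subseteq> y \<and> y \<subseteq> w2)) \<and>
     (\<forall>x\<in>prime_filters. \<forall>y\<in>prime_filters. x \<in> tense_rel G F `` {y} \<inter> Y \<longrightarrow>
        (\<exists>w1 \<in> (tense_rel G F)\<inverse> `` {x} \<inter> Y. \<exists>w2 \<in> (tense_rel G F)\<inverse> `` {x} \<inter> Y.
           w1 \<subseteq> y \<and> y \<subseteq> w2))"

definition closed_tPS_sets :: "('a::lattice \<Rightarrow> 'a) \<Rightarrow> ('a \<Rightarrow> 'a) \<Rightarrow> 'a set set set" where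
  "closed_tPS_sets G F = {Y. closedin priestley_topology Y \<and> tPS_set G F Y}"

end

theory Submission
  imports Defs
begin

text \<open>A closed set \<open>Y\<close> of prime filters corresponds to the lattice congruence \<open>dual_congruence Y\<close>
  identifying elements which \<open>Y\<close> cannot distinguish, and a congruence \<open>\<theta>\<close> to the closed set
  \<open>saturated_primes \<theta>\<close>. Since \<open>G a \<in> x\<close> iff \<open>a\<close> lies in all \<open>R\<close>-successors of \<open>x\<close>, and \<open>F a \<in> x\<close>
  iff \<open>a\<close> lies in some \<open>R\<close>-successor, the \<open>tPS\<close> conditions make \<open>dual_congruence Y\<close> compatible with
  the operators; conversely the prime filter theorem for saturated filters produces the witnesses
  \<open>w1\<close> and \<open>w2\<close>.\<close>

section \<open>Lattice congruences, filters and prime filters\<close>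

text \<open>The lattice part of \<open>tDL_congruence\<close>, kept separate because the separation
  arguments also apply to \<open>Id\<close> and to \<open>dual_congruence Y\<close> for arbitrary
  \<open>Y\<close>.\<close>

definition lattice_congruence :: "('a::lattice \<times> 'a) set \<Rightarrow> bool" where
  "lattice_congruence \<theta> \<longleftrightarrow>
     equiv UNIV \<theta> \<and>
     (\<forall>a b c d. (a, b) \<in> \<theta> \<longrightarrow> (c, d) \<in> \<theta> \<longrightarrow>
        (inf a c, inf b d) \<in> \<theta> \<and> (sup a c, sup b d) \<in> \<theta>)"

text \<open>For a lattice congruence \<open>\<theta>\<close>, these are the prime filters that are
  unions of \<open>\<theta>\<close>-classes, that is, the preimages of the prime filters of the
  quotient lattice.\<close>

definition saturated_primes :: "('a::lattice \<times> 'a) set \<Rightarrow> 'a set set" where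
  "saturated_primes \<theta> = {S \<in> prime_filters. \<theta> `` S \<subseteq> S}"

definition dual_congruence :: "'a::lattice set set \<Rightarrow> ('a \<times> 'a) set" where
  "dual_congruence Y = {(a, b). stone_map a \<inter> Y = stone_map b \<inter> Y}"

lemma congruence_refl: "lattice_congruence \<theta> \<Longrightarrow> (a, a) \<in> \<theta>"
  and congruence_sym: "lattice_congruence \<theta> \<Longrightarrow> (a, b) \<in> \<theta> \<Longrightarrow> (b, a) \<in> \<theta>"
  and congruence_trans: "lattice_congruence \<theta> \<Longrightarrow> (a, b) \<in> \<theta> \<Longrightarrow> (b, c) \<in> \<theta> \<Longrightarrow> (a, c) \<in> \<theta>"
  and congruence_inf: "lattice_congruence \<theta> \<Longrightarrow> (a, b) \<in> \<theta> \<Longrightarrow> (c, d) \<in> \<theta> \<Longrightarrow> (inf a c, inf b d) \<in> \<theta>"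
  and congruence_sup: "lattice_congruence \<theta> \<Longrightarrow> (a, b) \<in> \<theta> \<Longrightarrow> (c, d) \<in> \<theta> \<Longrightarrow> (sup a c, sup b d) \<in> \<theta>"
  unfolding lattice_congruence_def
  by (auto elim: equivE dest: refl_onD symD transD)

lemma lattice_congruence_Id: "lattice_congruence Id"
  by (auto simp: lattice_congruence_def equiv_def refl_on_def sym_def trans_def)

lemma
  assumes "lattice_filter T"
  shows filter_nonempty: "T \<noteq> {}"
    and filter_up: "a \<in> T \<Longrightarrow> a \<le> b \<Longrightarrow> b \<in> T"
    and filter_inf: "a \<in> T \<Longrightarrow> b \<in> T \<Longrightarrow> inf a b \<in> T"
  using assms by (auto simp: lattice_filter_def)

lemma lattice_filterI:
  assumes "T \<noteq> {}" "\<And>a b. a \<in> T \<Longrightarrow> a \<le> b \<Longrightarrow> b \<in> T" "\<And>a b. a \<in> T \<Longrightarrow> b \<in> T \<Longrightarrow> inf a b \<in> T"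
  shows "lattice_filter T"
  using assms by (auto simp: lattice_filter_def)

lemma
  fixes S :: "'a::bounded_lattice set"
  assumes "S \<in> prime_filters"
  shows prime_filter: "lattice_filter S"
    and prime_up: "a \<in> S \<Longrightarrow> a \<le> b \<Longrightarrow> b \<in> S"
    and prime_inf: "inf a b \<in> S \<longleftrightarrow> a \<in> S \<and> b \<in> S"
    and prime_sup: "sup a b \<in> S \<longleftrightarrow> a \<in> S \<or> b \<in> S"
    and prime_top: "top \<in> S"
    and prime_bot: "bot \<notin> S"
proof -
  show f: "lattice_filter S"
    using assms by (simp add: prime_filters_def)
  show up: "b \<in> S" if "a \<in> S" "a \<le> b" for a b
    using filter_up[OF f that] .
  show "inf a b \<in> S \<longleftrightarrow> a \<in> S \<and> b \<in> S"
    using up filter_inf[OF f] by (meson inf_le1 inf_le2)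
  show "sup a b \<in> S \<longleftrightarrow> a \<in> S \<or> b \<in> S"
    using assms up by (auto simp: prime_filters_def intro: sup_ge1 sup_ge2)
  show "top \<in> S"
    using filter_nonempty[OF f] up top_greatest by blast
  show "bot \<notin> S"
    using assms up bot_least unfolding prime_filters_def by blast
qed

section \<open>Saturated filters and the prime filter theorem\<close>

text \<open>Upward closure is the only delicate point: if \<open>d \<in> D\<close> is congruent to
  \<open>a\<close> and \<open>a \<le> b\<close>, then \<open>sup d b\<close> lies in
  \<open>D\<close> and is congruent to \<open>sup a b = b\<close>.\<close>

lemma lattice_filter_Image:
  assumes "lattice_congruence \<theta>" "lattice_filter D"
  shows "lattice_filter (\<theta> `` D)"
proof (rule lattice_filterI)
  show "\<theta> `` D \<noteq> {}"
    using filter_nonempty[OF assms(2)] congruence_refl[OF assms(1)] by blast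
next
  fix a b assume "a \<in> \<theta> `` D" "a \<le> b"
  then obtain d where d: "d \<in> D" "(d, a) \<in> \<theta>" by blast
  have "(sup d b, sup a b) \<in> \<theta>"
    using d congruence_sup[OF assms(1)] congruence_refl[OF assms(1)] by blast
  moreover have "sup a b = b" using \<open>a \<le> b\<close> by (rule sup_absorb2)
  moreover have "sup d b \<in> D" using filter_up[OF assms(2) d(1)] by simp
  ultimately show "b \<in> \<theta> `` D" by auto
next
  fix a b assume "a \<in> \<theta> `` D" "b \<in> \<theta> `` D"
  then show "inf a b \<in> \<theta> `` D"
    using congruence_inf[OF assms(1)] filter_inf[OF assms(2)] by blast
qed

lemma Image_Image_subset: "lattice_congruence \<theta> \<Longrightarrow> \<theta> `` (\<theta> `` D) \<subseteq> \<theta> `` D"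
  using congruence_trans by blast

lemma subset_Image: "lattice_congruence \<theta> \<Longrightarrow> D \<subseteq> \<theta> `` D"
  using congruence_refl by blast

text \<open>This is the filter generated by \<open>M\<close> and \<open>a\<close>. It serves the
  maximality argument below and the construction of successors in \<open>F_mem_iff\<close>.\<close>

lemma lattice_filter_adjoin:
  assumes "lattice_filter M"
  shows "lattice_filter {c. \<exists>m\<in>M. inf m a \<le> c}"
proof (rule lattice_filterI)
  show "{c. \<exists>m\<in>M. inf m a \<le> c} \<noteq> {}"
    using filter_nonempty[OF assms] by blast
next
  fix b c assume "b \<in> {c. \<exists>m\<in>M. inf m a \<le> c}" "b \<le> c"
  then show "c \<in> {c. \<exists>m\<in>M. inf m a \<le> c}" using order_trans by blast
next
  fix b c assume "b \<in> {c. \<exists>m\<in>M. inf m a \<le> c}" "c \<in> {c. \<exists>m\<in>M. inf m a \<le> c}"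
  then obtain m n where "m \<in> M" "inf m a \<le> b" "n \<in> M" "inf n a \<le> c" by blast
  moreover from this have "inf (inf m n) a \<le> inf b c"
    by (meson inf_le1 inf_le2 inf_greatest order_trans)
  ultimately show "inf b c \<in> {c. \<exists>m\<in>M. inf m a \<le> c}"
    using filter_inf[OF assms] by blast
qed

text \<open>The prime filter theorem of the quotient lattice, carried out with saturated filters
  instead of a quotient type: a filter maximal among the saturated ones that contain
  \<open>\<Phi>\<close> and miss \<open>I\<close> is prime. The set \<open>I\<close> is join-closed
  rather than an ideal, so that the elements \<open>sup a d\<close> in \<open>G_mem_iff\<close> can
  be avoided directly.\<close>

theorem saturated_prime_filter:
  fixes \<Phi> I :: "'a::{distrib_lattice, bounded_lattice} set"
  assumes \<theta>: "lattice_congruence \<theta>"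
    and \<Phi>: "lattice_filter \<Phi>" "\<theta> `` \<Phi> \<subseteq> \<Phi>"
    and I: "I \<noteq> {}" "\<And>a b. a \<in> I \<Longrightarrow> b \<in> I \<Longrightarrow> sup a b \<in> I"
    and disj: "\<Phi> \<inter> I = {}"
  obtains S where "S \<in> saturated_primes \<theta>" "\<Phi> \<subseteq> S" "S \<inter> I = {}"
proof -
  let ?A = "{M. lattice_filter M \<and> \<theta> `` M \<subseteq> M \<and> \<Phi> \<subseteq> M \<and> M \<inter> I = {}}"
  have "\<exists>M\<in>?A. \<forall>X\<in>?A. M \<subseteq> X \<longrightarrow> X = M"
  proof (rule subset_Zorn_nonempty)
    show "?A \<noteq> {}" using \<Phi> disj by blast
  next
    fix C assume C: "C \<noteq> {}" "subset.chain ?A C"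
    then have CA: "C \<subseteq> ?A" and lin: "\<And>X Y. X \<in> C \<Longrightarrow> Y \<in> C \<Longrightarrow> X \<subseteq> Y \<or> Y \<subseteq> X"
      using C(2) unfolding subset_chain_def by simp_all
    have fil: "lattice_filter X" and sat: "\<theta> `` X \<subseteq> X" and bd: "\<Phi> \<subseteq> X" "X \<inter> I = {}"
      if "X \<in> C" for X
      using CA that by (simp_all add: subset_iff)
    obtain X0 where X0: "X0 \<in> C" using C(1) by blast
    have "lattice_filter (\<Union>C)"
    proof (rule lattice_filterI)
      show "\<Union>C \<noteq> {}" using X0 filter_nonempty[OF fil[OF X0]] by auto
    next
      fix a b assume "a \<in> \<Union>C" "a \<le> b"
      then show "b \<in> \<Union>C" by (meson UnionE UnionI fil filter_up)
    next
      fix a b assume "a \<in> \<Union>C" "b \<in> \<Union>C"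
      then obtain X Y where XY: "X \<in> C" "a \<in> X" "Y \<in> C" "b \<in> Y" by (elim UnionE)
      then obtain Z where "Z \<in> C" "a \<in> Z" "b \<in> Z"
        using lin[OF XY(1,3)] by (elim disjE) (meson subsetD)+
      then show "inf a b \<in> \<Union>C" by (meson UnionI fil filter_inf)
    qed
    moreover have "\<theta> `` \<Union>C \<subseteq> \<Union>C"
    proof
      fix b assume "b \<in> \<theta> `` \<Union>C"
      then obtain a X where ab: "(a, b) \<in> \<theta>" "a \<in> X" and X: "X \<in> C" by (elim ImageE UnionE)
      have "b \<in> X" by (rule subsetD[OF sat[OF X] ImageI[OF ab]])
      with X show "b \<in> \<Union>C" by (rule UnionI)
    qed
    moreover have "\<Phi> \<subseteq> \<Union>C" using bd(1)[OF X0] X0 by (meson Union_upper order_trans)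
    moreover have "\<Union>C \<inter> I = {}" using bd(2) by (simp add: Int_Union2)
    ultimately show "\<Union>C \<in> ?A" by simp
  qed
  then obtain M where MA: "M \<in> ?A" and maxA: "\<forall>X\<in>?A. M \<subseteq> X \<longrightarrow> X = M"
    by (elim bexE)
  from MA have M: "lattice_filter M" "\<theta> `` M \<subseteq> M" "\<Phi> \<subseteq> M" "M \<inter> I = {}"
    by simp_all
  have max: "X = M" if "lattice_filter X" "\<theta> `` X \<subseteq> X" "M \<subseteq> X" "X \<inter> I = {}" for X
    using maxA that order_trans[OF M(3) that(3)] by simp
  \<comment> \<open>By maximality, the saturation of the filter generated by \<open>M\<close> and
    \<open>a\<close> must meet \<open>I\<close>.\<close>
  have ext: "\<exists>m\<in>M. \<exists>c i. inf m a \<le> c \<and> (c, i) \<in> \<theta> \<and> i \<in> I" if a: "a \<notin> M" for a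
  proof (rule ccontr)
    let ?D = "{c. \<exists>m\<in>M. inf m a \<le> c}"
    assume no: "\<not> ?thesis"
    have "M \<subseteq> ?D" by (auto intro: inf_le1)
    then have "M \<subseteq> \<theta> `` ?D" using subset_Image[OF \<theta>] by (rule order_trans)
    moreover have "\<theta> `` ?D \<inter> I = {}" using no by blast
    ultimately have "\<theta> `` ?D = M"
      by (rule max[OF lattice_filter_Image[OF \<theta> lattice_filter_adjoin[OF M(1)]]
          Image_Image_subset[OF \<theta>]])
    moreover have "a \<in> ?D" using filter_nonempty[OF M(1)] by (auto intro: inf_le2)
    then have "a \<in> \<theta> `` ?D" by (rule subsetD[OF subset_Image[OF \<theta>]])
    ultimately show False using a by simp
  qed
  have "a \<in> M \<or> b \<in> M" if ab: "sup a b \<in> M" for a b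
  proof (rule ccontr)
    assume "\<not> ?thesis"
    then have "a \<notin> M" "b \<notin> M" by simp_all
    obtain m c i where c: "m \<in> M" "inf m a \<le> c" "(c, i) \<in> \<theta>" "i \<in> I"
      using ext[OF \<open>a \<notin> M\<close>] by (elim bexE exE conjE)
    obtain n d j where d: "n \<in> M" "inf n b \<le> d" "(d, j) \<in> \<theta>" "j \<in> I"
      using ext[OF \<open>b \<notin> M\<close>] by (elim bexE exE conjE)
    \<comment> \<open>The two ways of reaching \<open>I\<close> are merged: distributivity puts
      \<open>sup c d\<close> into \<open>M\<close>, and saturation then puts the congruent element
      \<open>sup i j\<close> of \<open>I\<close> there too.\<close>
    have "inf (inf m n) a \<le> sup c d"
      by (rule order_trans[OF inf_mono[OF inf_le1 order_refl] le_supI1[OF c(2)]])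
    moreover have "inf (inf m n) b \<le> sup c d"
      by (rule order_trans[OF inf_mono[OF inf_le2 order_refl] le_supI2[OF d(2)]])
    ultimately have "inf (inf m n) (sup a b) \<le> sup c d"
      by (simp add: inf_sup_distrib1)
    moreover have "inf (inf m n) (sup a b) \<in> M"
      using ab c(1) d(1) by (intro filter_inf[OF M(1)])
    ultimately have "sup c d \<in> M"
      by (rule filter_up[OF M(1), rotated])
    then have "sup i j \<in> M"
      by (rule subsetD[OF M(2) ImageI[OF congruence_sup[OF \<theta> c(3) d(3)]]])
    then show False using I(2)[OF c(4) d(4)] M(4) by blast
  qed
  moreover have "M \<noteq> UNIV" using I(1) M(4) by blast
  ultimately have "M \<in> saturated_primes \<theta>"
    using M(1,2) by (auto simp: saturated_primes_def prime_filters_def)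
  then show thesis using that M(3,4) by blast
qed

text \<open>Every filter is saturated with respect to \<open>Id\<close>.\<close>

corollary prime_filter_separation:
  fixes \<Phi> I :: "'a::{distrib_lattice, bounded_lattice} set"
  assumes "lattice_filter \<Phi>" "I \<noteq> {}" "\<And>a b. a \<in> I \<Longrightarrow> b \<in> I \<Longrightarrow> sup a b \<in> I" "\<Phi> \<inter> I = {}"
  obtains S where "S \<in> prime_filters" "\<Phi> \<subseteq> S" "S \<inter> I = {}"
  by (rule saturated_prime_filter[OF lattice_congruence_Id assms(1) _ assms(2-4)])
    (auto simp: saturated_primes_def)

lemma lattice_filter_principal: "lattice_filter {a..}"
  by (rule lattice_filterI) (auto intro: order_trans)

text \<open>If \<open>top\<close> and \<open>bot\<close> are not congruent, the class of
  \<open>top\<close> is a saturated filter missing \<open>bot\<close>, so it extends to a saturated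
  prime filter. If they are congruent, meeting the pair with any \<open>a\<close> shows that
  \<open>a\<close> is congruent to \<open>bot\<close>.\<close>

lemma saturated_primes_eq_empty:
  assumes \<theta>: "lattice_congruence \<theta>" and empty: "saturated_primes \<theta> = {}"
  shows "\<theta> = (UNIV :: ('a::{distrib_lattice, bounded_lattice} \<times> 'a) set)"
proof -
  have 1: "(top, bot) \<in> \<theta>"
  proof (rule ccontr)
    assume no: "(top, bot) \<notin> \<theta>"
    have "\<theta> `` {top..} \<inter> {bot} = {}" using no by (auto simp: top_unique)
    then show False
      using saturated_prime_filter[OF \<theta> lattice_filter_Image[OF \<theta> lattice_filter_principal]
          Image_Image_subset[OF \<theta>], of "{bot}"] empty by auto
  qed
  have 2: "(a, bot) \<in> \<theta>" for a
    using congruence_inf[OF \<theta> 1 congruence_refl[OF \<theta>, of a]] by simp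
  have "(a, b) \<in> \<theta>" for a b
    by (rule congruence_trans[OF \<theta> 2 congruence_sym[OF \<theta> 2]])
  then show ?thesis by auto
qed

text \<open>A prime filter that contains \<open>a\<close> but not \<open>b\<close> cannot be
  saturated if \<open>a\<close> and \<open>b\<close> are congruent; hence congruent elements are
  below each other.\<close>

lemma saturated_primes_eq_all:
  assumes \<theta>: "lattice_congruence \<theta>" and all: "saturated_primes \<theta> = prime_filters"
  shows "\<theta> = (Id :: ('a::{distrib_lattice, bounded_lattice} \<times> 'a) set)"
proof -
  have "a \<le> b" if ab: "(a, b) \<in> \<theta>" for a b
  proof (rule ccontr)
    assume "\<not> a \<le> b"
    then obtain S where S: "S \<in> prime_filters" "{a..} \<subseteq> S" "S \<inter> {b} = {}"
      using prime_filter_separation[OF lattice_filter_principal, of "{b}" a] by auto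
    then have "\<theta> `` S \<subseteq> S" using all by (auto simp: saturated_primes_def)
    then show False using S(2,3) ab by auto
  qed
  then have "\<theta> \<subseteq> Id" using congruence_sym[OF \<theta>] by (auto intro: antisym)
  then show ?thesis using congruence_refl[OF \<theta>] by auto
qed

section \<open>The Priestley topology\<close>

lemma topspace_priestley:
  "topspace priestley_topology = (prime_filters :: 'a::lattice set set)"
proof -
  have "stone_map a \<subseteq> prime_filters" for a :: 'a by (auto simp: stone_map_def)
  then show ?thesis
    unfolding priestley_topology_def topology_generated_by_topspace by auto
qed

lemma openin_stone_diff:
  "openin priestley_topology (stone_map a - stone_map b)"
proof -
  have "openin priestley_topology (stone_map a)"
    and "openin priestley_topology (prime_filters - stone_map b)"
    unfolding priestley_topology_def by (auto intro: topology_generated_by_Basis)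
  moreover have "stone_map a - stone_map b = stone_map a \<inter> (prime_filters - stone_map b)"
    by (auto simp: stone_map_def)
  ultimately show ?thesis by (metis openin_Int)
qed

text \<open>The differences \<open>stone_map a - stone_map b\<close> form a base: they include the
  subbasic sets, since \<open>bot\<close> lies in no prime filter and \<open>top\<close> in all, and
  two of them intersect in the difference for \<open>inf a c\<close> and
  \<open>sup b d\<close>.\<close>

lemma priestley_basic_neighbourhood:
  fixes x :: "'a::bounded_lattice set"
  assumes "openin priestley_topology U" "x \<in> U"
  shows "\<exists>a b. x \<in> stone_map a - stone_map b \<and> stone_map a - stone_map b \<subseteq> U"
proof -
  let ?S = "range stone_map \<union> range (\<lambda>a. prime_filters - stone_map a) :: 'a set set set"
  have "generate_topology_on ?S U"
    using assms(1) unfolding priestley_topology_def openin_topology_generated_by_iff .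
  then show ?thesis using assms(2)
  proof induction
    case Empty
    then show ?case by simp
  next
    case (Int U V)
    then obtain a b c d where
      ab: "x \<in> stone_map a - stone_map b" "stone_map a - stone_map b \<subseteq> U" and
      cd: "x \<in> stone_map c - stone_map d" "stone_map c - stone_map d \<subseteq> V" by blast
    have eq: "stone_map (inf a c) - stone_map (sup b d)
        = (stone_map a - stone_map b) \<inter> (stone_map c - stone_map d)"
      by (auto simp: stone_map_def prime_inf prime_sup)
    show ?case
      by (rule exI[of _ "inf a c"], rule exI[of _ "sup b d"]) (use ab cd in \<open>auto simp: eq\<close>)
  next
    case (UN K)
    then obtain U where "U \<in> K" "x \<in> U" by blast
    then show ?case using UN.IH by blast
  next
    case (Basis U)
    then consider a where "U = stone_map a" | b where "U = prime_filters - stone_map b" by blast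
    then show ?case
    proof cases
      case (1 a)
      then have "U = stone_map a - stone_map bot"
        by (auto simp: stone_map_def prime_bot)
      then show ?thesis using Basis.prems by blast
    next
      case (2 b)
      then have "U = stone_map top - stone_map b"
        by (auto simp: stone_map_def prime_top)
      then show ?thesis using Basis.prems by blast
    qed
  qed
qed

section \<open>Extreme values of the dual congruence, and closedness of saturated primes\<close>

lemma dual_congruence_lattice:
  "lattice_congruence (dual_congruence (Y :: 'a::bounded_lattice set set))"
proof -
  have "stone_map (inf a b) = stone_map a \<inter> stone_map b"
    and "stone_map (sup a b) = stone_map a \<union> stone_map b" for a b :: 'a
    by (auto simp: stone_map_def prime_inf prime_sup)
  then show ?thesis
    unfolding lattice_congruence_def dual_congruence_def
    by (auto simp: equiv_def refl_on_def sym_def trans_def)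
qed

lemma dual_congruence_eq_UNIV:
  fixes Y :: "'a::bounded_lattice set set"
  assumes "Y \<subseteq> prime_filters" "dual_congruence Y = UNIV"
  shows "Y = {}"
proof -
  have "stone_map top \<inter> Y = stone_map bot \<inter> Y"
    using assms(2) by (auto simp: dual_congruence_def)
  moreover have "stone_map (top::'a) = prime_filters" "stone_map (bot::'a) = {}"
    by (auto simp: stone_map_def prime_top prime_bot)
  ultimately show ?thesis using assms(1) by auto
qed

text \<open>A point outside the closed set \<open>Y\<close> has a basic neighbourhood
  \<open>stone_map a - stone_map b\<close> disjoint from \<open>Y\<close>. Then \<open>Y\<close>
  cannot distinguish \<open>inf a b\<close> from \<open>a\<close>, so \<open>a \<le> b\<close>, and
  the neighbourhood is empty.\<close>

lemma dual_congruence_eq_Id: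
  fixes Y :: "'a::bounded_lattice set set"
  assumes Y: "closedin priestley_topology Y" and Id: "dual_congruence Y = Id"
  shows "Y = prime_filters"
proof (rule ccontr)
  have sub: "Y \<subseteq> prime_filters" and op: "openin priestley_topology (prime_filters - Y)"
    using Y by (auto simp: closedin_def topspace_priestley)
  assume "Y \<noteq> prime_filters"
  with sub obtain x where x: "x \<in> prime_filters" "x \<notin> Y" by blast
  with op obtain a b where ab: "x \<in> stone_map a - stone_map b"
    "stone_map a - stone_map b \<subseteq> prime_filters - Y"
    using priestley_basic_neighbourhood[of "prime_filters - Y" x] by blast
  have "stone_map (inf a b) = stone_map a \<inter> stone_map b"
    by (auto simp: stone_map_def prime_inf)
  then have "(inf a b, a) \<in> dual_congruence Y"
    using ab(2) by (auto simp: dual_congruence_def)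
  then have "a \<le> b" using Id by (auto simp: inf.order_iff)
  then show False using ab(1) prime_up[OF x(1)] by (auto simp: stone_map_def)
qed

text \<open>A prime filter fails to be saturated exactly when some pair \<open>(a, b)\<close> in
  \<open>\<theta>\<close> has \<open>a\<close> inside and \<open>b\<close> outside, which is an open
  condition.\<close>

lemma closedin_saturated_primes:
  "closedin priestley_topology (saturated_primes \<theta>)"
proof -
  have "prime_filters - saturated_primes \<theta> = (\<Union>(a, b)\<in>\<theta>. stone_map a - stone_map b)"
    by (auto simp: saturated_primes_def stone_map_def)
  moreover have "openin priestley_topology (\<Union>(a, b)\<in>\<theta>. stone_map a - stone_map b)"
    by (auto intro!: openin_Union openin_stone_diff)
  ultimately show ?thesis
    by (auto simp: closedin_def topspace_priestley saturated_primes_def)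
qed

section \<open>The tPS conditions and the tense relation\<close>

text \<open>The common form of (tc1) and (tc2): the first is this condition for the tense relation,
  the second is the same condition for its converse.\<close>

definition enclosing_successors :: "('a set \<times> 'a set) set \<Rightarrow> 'a set set \<Rightarrow> bool" where
  "enclosing_successors R Y \<longleftrightarrow>
     (\<forall>x\<in>Y. \<forall>y. (x, y) \<in> R \<longrightarrow>
        (\<exists>w1\<in>Y. \<exists>w2\<in>Y. (x, w1) \<in> R \<and> (x, w2) \<in> R \<and> w1 \<subseteq> y \<and> y \<subseteq> w2))"

lemma tPS_set_iff:
  "tPS_set G F Y \<longleftrightarrow> Y \<subseteq> prime_filters \<and>
     enclosing_successors (tense_rel G F) Y \<and> enclosing_successors ((tense_rel G F)\<inverse>) Y"
proof -
  have 1: "x \<in> prime_filters" "y \<in> prime_filters" if "(x, y) \<in> tense_rel G F" for x y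
    using that by (auto simp: tense_rel_def)
  show ?thesis
    unfolding tPS_set_def enclosing_successors_def Int_iff Image_singleton_iff converse_iff
      Bex_def Ball_def conj_assoc
    by (intro conj_cong refl iffI allI impI) (meson 1 subsetD)+
qed

context tDL_algebra
begin

text \<open>The axioms are symmetric under exchanging \<open>G\<close> with \<open>H\<close> and
  \<open>F\<close> with \<open>P\<close>, so each result about \<open>G\<close>, \<open>F\<close>
  and the relation also yields its mirror image.\<close>

lemma converse_algebra: "tDL_algebra H G P F"
  using tDL_algebra_axioms unfolding tDL_algebra_def by blast

lemma G_mono: "x \<le> y \<Longrightarrow> G x \<le> G y"
  by (metis G_inf inf.order_iff)

lemma F_mono: "x \<le> y \<Longrightarrow> F x \<le> F y"
  by (metis F_sup sup.order_iff sup_commute)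

text \<open>The adjunctions translate one pair of bounds into the other:
  \<open>F (H a) \<le> a\<close> gives the bound for \<open>H\<close>, and
  \<open>a \<le> G (P a)\<close> the bound for \<open>P\<close>. The mirror image supplies the
  reverse inclusion in \<open>tense_rel_converse\<close>.\<close>

lemma tense_rel_subset: "tense_rel G F \<subseteq> (tense_rel H P)\<inverse>"
proof clarify
  fix S T assume ST: "(S, T) \<in> tense_rel G F"
  then have S: "S \<in> prime_filters" and T: "T \<in> prime_filters"
    and G: "\<And>a. G a \<in> S \<Longrightarrow> a \<in> T" and F: "\<And>a. a \<in> T \<Longrightarrow> F a \<in> S"
    by (auto simp: tense_rel_def)
  have "a \<in> S" if "H a \<in> T" for a
    using prime_up[OF S F[OF that] FH_le] .
  moreover have "P a \<in> T" if "a \<in> S" for a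
    using G[OF prime_up[OF S that le_GP]] .
  ultimately show "(T, S) \<in> tense_rel H P"
    using S T by (auto simp: tense_rel_def)
qed

lemma tense_rel_converse: "(tense_rel G F)\<inverse> = tense_rel H P"
  using tense_rel_subset tDL_algebra.tense_rel_subset[OF converse_algebra] by blast

section \<open>The operators described by successors\<close>

lemma G_preimage_filter:
  assumes "S \<in> prime_filters"
  shows "lattice_filter {a. G a \<in> S}"
proof (rule lattice_filterI)
  show "{a. G a \<in> S} \<noteq> {}" using G_top prime_top[OF assms] by (metis empty_iff mem_Collect_eq)
qed (use G_mono prime_up[OF assms] in \<open>auto simp: G_inf prime_inf[OF assms]\<close>)

text \<open>If \<open>G a \<notin> S\<close>, a successor of \<open>S\<close> omitting
  \<open>a\<close> is found by separating the filter of all \<open>b\<close> with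
  \<open>G b \<in> S\<close> from a suitable join-closed set.\<close>

lemma G_mem_iff:
  assumes S: "S \<in> prime_filters"
  shows "G a \<in> S \<longleftrightarrow> (\<forall>T. (S, T) \<in> tense_rel G F \<longrightarrow> a \<in> T)"
proof
  assume all: "\<forall>T. (S, T) \<in> tense_rel G F \<longrightarrow> a \<in> T"
  show "G a \<in> S"
  proof (rule ccontr)
    assume no: "G a \<notin> S"
    \<comment> \<open>Avoiding these joins does two things at once: \<open>d = bot\<close> excludes
      \<open>a\<close> from \<open>T\<close>, and the remaining \<open>d\<close> force
      \<open>F d \<in> S\<close> for every \<open>d \<in> T\<close>.\<close>
    let ?I = "{sup a d | d. F d \<notin> S}"
    have bot: "F bot \<notin> S" using F_bot prime_bot[OF S] by simp
    have "sup b c \<in> ?I" if "b \<in> ?I" "c \<in> ?I" for b c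
    proof -
      from that obtain d e where "b = sup a d" "F d \<notin> S" "c = sup a e" "F e \<notin> S" by blast
      moreover from this have "F (sup d e) \<notin> S" by (simp add: F_sup prime_sup[OF S])
      moreover have "sup (sup a d) (sup a e) = sup a (sup d e)"
        by (simp add: sup_assoc sup_left_commute)
      ultimately show ?thesis by auto
    qed
    \<comment> \<open>Disjointness: by \<open>G_sup_le\<close>, \<open>G (sup a d) \<in> S\<close>
      would give \<open>G a \<in> S\<close> or \<open>F d \<in> S\<close>.\<close>
    moreover have "G (sup a d) \<notin> S" if "F d \<notin> S" for d
      using no that prime_up[OF S _ G_sup_le] by (auto simp: prime_sup[OF S])
    ultimately obtain T where T: "T \<in> prime_filters" "{a. G a \<in> S} \<subseteq> T" "T \<inter> ?I = {}"
      using prime_filter_separation[OF G_preimage_filter[OF S], of ?I] bot by blast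
    have sup: "sup a d \<notin> T" if "F d \<notin> S" for d
      using T(3) that by blast
    have "a \<notin> T" and "T \<subseteq> {a. F a \<in> S}"
      using sup[OF bot] sup by (auto simp: prime_sup[OF T(1)])
    then show False using all T(1,2) S by (auto simp: tense_rel_def)
  qed
qed (auto simp: tense_rel_def)

text \<open>A successor containing \<open>a\<close> must extend the filter generated by
  \<open>a\<close> and all \<open>d\<close> with \<open>G d \<in> S\<close>, and must avoid all
  \<open>c\<close> with \<open>F c \<notin> S\<close>. These sets are disjoint by
  \<open>G_inf_F_le\<close>.\<close>

lemma F_mem_iff:
  assumes S: "S \<in> prime_filters"
  shows "F a \<in> S \<longleftrightarrow> (\<exists>T. (S, T) \<in> tense_rel G F \<and> a \<in> T)"
proof
  assume Fa: "F a \<in> S"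
  let ?D = "{c. \<exists>d\<in>{d. G d \<in> S}. inf d a \<le> c}" and ?I = "{c. F c \<notin> S}"
  have "?D \<inter> ?I = {}"
  proof -
    have "F c \<in> S" if "G d \<in> S" "inf d a \<le> c" for c d
    proof -
      have "inf (G d) (F a) \<in> S" using that(1) Fa by (simp add: prime_inf[OF S])
      then show ?thesis
        using prime_up[OF S] G_inf_F_le F_mono[OF that(2)] by blast
    qed
    then show ?thesis by blast
  qed
  moreover have "bot \<in> ?I" using F_bot prime_bot[OF S] by simp
  moreover have "sup b c \<in> ?I" if "b \<in> ?I" "c \<in> ?I" for b c
    using that by (simp add: F_sup prime_sup[OF S])
  ultimately obtain T where T: "T \<in> prime_filters" "?D \<subseteq> T" "T \<inter> ?I = {}"
    using prime_filter_separation[OF lattice_filter_adjoin[OF G_preimage_filter[OF S]], of ?I a]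
    by blast
  have "G top \<in> S" using G_top prime_top[OF S] by simp
  then have "a \<in> ?D" by (auto intro!: exI[of _ top])
  moreover have "{d. G d \<in> S} \<subseteq> ?D" by (auto intro: inf_le1)
  ultimately have "a \<in> T" "{d. G d \<in> S} \<subseteq> T" "T \<subseteq> {c. F c \<in> S}"
    using T(2,3) by blast+
  then show "\<exists>T. (S, T) \<in> tense_rel G F \<and> a \<in> T"
    using T(1) S by (auto simp: tense_rel_def)
qed (auto simp: tense_rel_def)

section \<open>Translating between tPS-sets and congruences\<close>

text \<open>Elements can be exchanged only at points of \<open>Y\<close>, so an arbitrary successor
  \<open>y\<close> is replaced by one in \<open>Y\<close>: for \<open>G\<close> by one below
  \<open>y\<close>, from which membership passes up to \<open>y\<close>; for \<open>F\<close> by one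
  above \<open>y\<close>, which inherits the element from \<open>y\<close>.\<close>

lemma dual_congruence_G_F:
  assumes Y: "Y \<subseteq> prime_filters" "enclosing_successors (tense_rel G F) Y"
    and ab: "(a, b) \<in> dual_congruence Y"
  shows "(G a, G b) \<in> dual_congruence Y" and "(F a, F b) \<in> dual_congruence Y"
proof -
  have mono: "G b \<in> x" if "G a \<in> x" and x: "x \<in> Y"
      and ab: "\<And>w. w \<in> Y \<Longrightarrow> a \<in> w \<longleftrightarrow> b \<in> w" for x a b
  proof -
    have "b \<in> y" if xy: "(x, y) \<in> tense_rel G F" for y
    proof -
      obtain w where "w \<in> Y" "(x, w) \<in> tense_rel G F" "w \<subseteq> y"
        using Y(2) x xy unfolding enclosing_successors_def by blast
      then show ?thesis using \<open>G a \<in> x\<close> ab by (auto simp: tense_rel_def)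
    qed
    then show ?thesis using G_mem_iff Y(1) x by blast
  qed
  have mono': "F b \<in> x" if "F a \<in> x" and x: "x \<in> Y"
      and ab: "\<And>w. w \<in> Y \<Longrightarrow> a \<in> w \<longleftrightarrow> b \<in> w" for x a b
  proof -
    obtain y where "(x, y) \<in> tense_rel G F" "a \<in> y"
      using F_mem_iff \<open>F a \<in> x\<close> Y(1) x by blast
    then obtain w where "w \<in> Y" "(x, w) \<in> tense_rel G F" "a \<in> w"
      using Y(2) x unfolding enclosing_successors_def by blast
    then show ?thesis using ab by (auto simp: tense_rel_def)
  qed
  have eq: "(c, d) \<in> dual_congruence Y \<longleftrightarrow> (\<forall>w\<in>Y. c \<in> w \<longleftrightarrow> d \<in> w)" for c d
    using Y(1) by (auto simp: dual_congruence_def stone_map_def)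
  have ab': "a \<in> w \<longleftrightarrow> b \<in> w" if "w \<in> Y" for w
    using ab that by (simp add: eq)
  show "(G a, G b) \<in> dual_congruence Y"
    unfolding eq using mono[of a _ b] mono[of b _ a] ab' by metis
  show "(F a, F b) \<in> dual_congruence Y"
    unfolding eq using mono'[of a _ b] mono'[of b _ a] ab' by metis
qed

lemma tDL_congruence_dual:
  assumes "tPS_set G F Y"
  shows "tDL_congruence G H F P (dual_congruence Y)"
proof -
  have Y: "Y \<subseteq> prime_filters" "enclosing_successors (tense_rel G F) Y"
    "enclosing_successors (tense_rel H P) Y"
    using assms by (simp_all add: tPS_set_iff tense_rel_converse)
  have "(G a, G b) \<in> dual_congruence Y \<and> (H a, H b) \<in> dual_congruence Y
      \<and> (F a, F b) \<in> dual_congruence Y \<and> (P a, P b) \<in> dual_congruence Y"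
    if "(a, b) \<in> dual_congruence Y" for a b
    using dual_congruence_G_F[OF Y(1,2) that]
      tDL_algebra.dual_congruence_G_F[OF converse_algebra Y(1,3) that] by simp
  then show ?thesis
    using dual_congruence_lattice[of Y]
    unfolding tDL_congruence_def lattice_congruence_def by simp
qed

lemma enclosing_successors_saturated_primes:
  assumes \<theta>: "lattice_congruence \<theta>"
    and G: "\<And>a b. (a, b) \<in> \<theta> \<Longrightarrow> (G a, G b) \<in> \<theta>" and F: "\<And>a b. (a, b) \<in> \<theta> \<Longrightarrow> (F a, F b) \<in> \<theta>"
  shows "enclosing_successors (tense_rel G F) (saturated_primes \<theta>)"
  unfolding enclosing_successors_def
proof (intro ballI allI impI)
  fix x y assume "x \<in> saturated_primes \<theta>" and xy: "(x, y) \<in> tense_rel G F"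
  then have x: "x \<in> prime_filters" and sat: "\<theta> `` x \<subseteq> x" and y: "y \<in> prime_filters"
    and Gx: "{a. G a \<in> x} \<subseteq> y" and Fx: "y \<subseteq> {a. F a \<in> x}"
    by (auto simp: saturated_primes_def tense_rel_def)
  \<comment> \<open>The lower witness \<open>w1\<close> lies between the filter of all
    \<open>a\<close> with \<open>G a \<in> x\<close> and \<open>y\<close>, so \<open>- y\<close> is
    the set to avoid.\<close>
  have "\<theta> `` {a. G a \<in> x} \<subseteq> {a. G a \<in> x}" using G sat by blast
  moreover have "sup a b \<in> - y" if "a \<in> - y" "b \<in> - y" for a b
    using that by (simp add: prime_sup[OF y])
  moreover have "- y \<noteq> {}" using prime_bot[OF y] by blast
  ultimately obtain w1 where w1: "w1 \<in> saturated_primes \<theta>" "{a. G a \<in> x} \<subseteq> w1" "w1 \<inter> - y = {}"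
    using saturated_prime_filter[OF \<theta> G_preimage_filter[OF x], of "- y"] Gx by blast
  let ?I = "{a. F a \<notin> x}"
  \<comment> \<open>The upper witness \<open>w2\<close> extends the saturation of \<open>y\<close>.
    If \<open>a \<in> y\<close> is congruent to \<open>b\<close>, then \<open>F a \<in> x\<close> is
    congruent to \<open>F b\<close>, so \<open>F b \<in> x\<close> because \<open>x\<close> is
    saturated.\<close>
  have "\<theta> `` y \<inter> ?I = {}" using F sat Fx by blast
  moreover have "bot \<in> ?I" using F_bot prime_bot[OF x] by simp
  moreover have "sup a b \<in> ?I" if "a \<in> ?I" "b \<in> ?I" for a b
    using that by (simp add: F_sup prime_sup[OF x])
  ultimately obtain w2 where w2: "w2 \<in> saturated_primes \<theta>" "\<theta> `` y \<subseteq> w2" "w2 \<inter> ?I = {}"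
    using saturated_prime_filter[OF \<theta> lattice_filter_Image[OF \<theta> prime_filter[OF y]]
        Image_Image_subset[OF \<theta>], of ?I] by blast
  have "w1 \<subseteq> y" "y \<subseteq> w2" "w1 \<in> prime_filters" "w2 \<in> prime_filters"
    using w1 w2 subset_Image[OF \<theta>, of y] by (auto simp: saturated_primes_def)
  \<comment> \<open>Each witness inherits its second bound from \<open>y\<close>: the upper bound
    for \<open>w1\<close> from \<open>w1 \<subseteq> y\<close>, the lower bound for
    \<open>w2\<close> from \<open>y \<subseteq> w2\<close>.\<close>
  moreover from this have "(x, w1) \<in> tense_rel G F" "(x, w2) \<in> tense_rel G F"
    using x w1(2) w2(3) Gx Fx by (auto simp: tense_rel_def)
  ultimately show "\<exists>w1\<in>saturated_primes \<theta>. \<exists>w2\<in>saturated_primes \<theta>.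
      (x, w1) \<in> tense_rel G F \<and> (x, w2) \<in> tense_rel G F \<and> w1 \<subseteq> y \<and> y \<subseteq> w2"
    using w1(1) w2(1) by blast
qed

lemma closed_tPS_saturated_primes:
  assumes "tDL_congruence G H F P \<theta>"
  shows "saturated_primes \<theta> \<in> closed_tPS_sets G F"
proof -
  have \<theta>: "lattice_congruence \<theta>"
    using assms by (simp add: tDL_congruence_def lattice_congruence_def)
  have compat: "(G a, G b) \<in> \<theta>" "(H a, H b) \<in> \<theta>" "(F a, F b) \<in> \<theta>" "(P a, P b) \<in> \<theta>"
    if "(a, b) \<in> \<theta>" for a b
    using assms that by (simp_all add: tDL_congruence_def)
  have "enclosing_successors (tense_rel G F) (saturated_primes \<theta>)"
    by (rule enclosing_successors_saturated_primes[OF \<theta> compat(1,3)])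
  moreover have "enclosing_successors (tense_rel H P) (saturated_primes \<theta>)"
    by (rule tDL_algebra.enclosing_successors_saturated_primes[OF converse_algebra \<theta> compat(2,4)])
  ultimately show ?thesis
    using closedin_saturated_primes[of \<theta>]
    by (auto simp: closed_tPS_sets_def tPS_set_iff tense_rel_converse saturated_primes_def)
qed

text \<open>In the whole space, \<open>y\<close> itself serves as both \<open>w1\<close> and
  \<open>w2\<close>.\<close>

lemma closed_tPS_trivial: "{} \<in> closed_tPS_sets G F" "prime_filters \<in> closed_tPS_sets G F"
proof -
  have "closedin priestley_topology (prime_filters :: 'a set set)"
    using closedin_topspace[of priestley_topology] by (simp add: topspace_priestley)
  then show "{} \<in> closed_tPS_sets G F" "prime_filters \<in> closed_tPS_sets G F"
    unfolding closed_tPS_sets_def tPS_set_def by (auto simp: tense_rel_def)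
qed

lemma tDL_congruence_trivial: "tDL_congruence G H F P Id" "tDL_congruence G H F P UNIV"
  by (auto simp: tDL_congruence_def equiv_def refl_on_def sym_def trans_def)

end

section \<open>Simplicity in terms of closed tPS-sets\<close>

theorem theorem4p15:
  fixes G H F P :: "'a::{distrib_lattice, bounded_lattice} \<Rightarrow> 'a"
  assumes "tDL_algebra G H F P"
  shows "tDL_simple G H F P \<longleftrightarrow> closed_tPS_sets G F = {{}, prime_filters}"
proof -
  interpret tDL_algebra G H F P by (rule assms)
  show ?thesis
  proof
    assume simple: "tDL_simple G H F P"
    have "Y = {} \<or> Y = prime_filters" if "Y \<in> closed_tPS_sets G F" for Y
    proof -
      have Y: "closedin priestley_topology Y" "tPS_set G F Y" "Y \<subseteq> prime_filters"
        using that by (auto simp: closed_tPS_sets_def tPS_set_def)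
      then have "dual_congruence Y = Id \<or> dual_congruence Y = UNIV"
        using simple tDL_congruence_dual unfolding tDL_simple_def by blast
      then show ?thesis
        using dual_congruence_eq_Id dual_congruence_eq_UNIV Y by blast
    qed
    then show "closed_tPS_sets G F = {{}, prime_filters}"
      using closed_tPS_trivial by blast
  next
    assume closed: "closed_tPS_sets G F = {{}, prime_filters}"
    have "\<theta> = Id \<or> \<theta> = UNIV" if "tDL_congruence G H F P \<theta>" for \<theta>
    proof -
      have "lattice_congruence \<theta>"
        using that by (simp add: tDL_congruence_def lattice_congruence_def)
      moreover have "saturated_primes \<theta> = {} \<or> saturated_primes \<theta> = prime_filters"
        using closed_tPS_saturated_primes[OF that] by (simp add: closed)
      ultimately show ?thesis
        using saturated_primes_eq_empty saturated_primes_eq_all by metis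
    qed
    then show "tDL_simple G H F P"
      using tDL_congruence_trivial unfolding tDL_simple_def by blast
  qed
qed

end
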